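(* Let $w_1,w_2,w_3$ be any odd positive integers, let $y_1,y_2\in\mathbb{Z}_p$, and let $n\ge 0$ be an integer. Then the following six expressions are all equal: \begin{align*} &w_1^n\sum_{k=0}^{n}\binom{n}{k}E_{k,\chi,\xi^{w_1w_2}}(w_3y_1)\sum_{a=0}^{w_1d-1}(-1)^a\chi(a)\xi^{aw_2w_3}E_{n-k,\chi,\xi^{w_1w_3}}\Big(w_2y_2+\frac{w_2}{w_1}a\Big)w_3^{n-k}w_2^k\\ =&w_1^n\sum_{k=0}^{n}\binom{n}{k}E_{k,\chi,\xi^{w_1w_3}}(w_2y_1)\sum_{a=0}^{w_1d-1}(-1)^a\chi(a)\xi^{aw_2w_3}E_{n-k,\chi,\xi^{w_1w_2}}\Big(w_3y_2+\frac{w_3}{w_1}a\Big)w_2^{n-k}w_3^k\\ =&w_2^n\sum_{k=0}^{n}\binom{n}{k}E_{k,\chi,\xi^{w_1w_2}}(w_3y_1)\sum_{a=0}^{w_2d-1}(-1)^a\chi(a)\xi^{aw_1w_3}E_{n-k,\chi,\xi^{w_2w_3}}\Big(w_1y_2+\frac{w_1}{w_2}a\Big)w_3^{n-k}w_1^k\\ =&w_2^n\sum_{k=0}^{n}\binom{n}{k}E_{k,\chi,\xi^{w_2w_3}}(w_1y_1)\sum_{a=0}^{w_2d-1}(-1)^a\chi(a)\xi^{aw_1w_3}E_{n-k,\chi,\xi^{w_1w_2}}\Big(w_3y_2+\frac{w_3}{w_2}a\Big)w_1^{n-k}w_3^k\\ =&w_3^n\sum_{k=0}^{n}\binom{n}{k}E_{k,\chi,\xi^{w_1w_3}}(w_2y_1)\sum_{a=0}^{w_3d-1}(-1)^a\chi(a)\xi^{aw_1w_2}E_{n-k,\chi,\xi^{w_2w_3}}\Big(w_1y_2+\frac{w_1}{w_3}a\Big)w_2^{n-k}w_1^k\\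 =&w_3^n\sum_{k=0}^{n}\binom{n}{k}E_{k,\chi,\xi^{w_2w_3}}(w_1y_1)\sum_{a=0}^{w_3d-1}(-1)^a\chi(a)\xi^{aw_1w_2}E_{n-k,\chi,\xi^{w_1w_3}}\Big(w_2y_2+\frac{w_2}{w_3}a\Big)w_1^{n-k}w_2^k. \end{align*}
   Context: Let $p$ be a fixed odd prime, $\mathbb{Z}_p$ the $p$-adic integers, $\mathbb{C}_p$ the completion of an algebraic closure of $\mathbb{Q}_p$. Let $\xi\in\mathbb{C}_p$ be a fixed ramified root of unity, i.e. $\xi^{p^s}=1$ for some positive integer $s$. Let $d$ be a fixed odd positive integer and $\chi$ a primitive Dirichlet character of conductor $d$, regarded as a function on the integers (periodic mod $d$, zero on integers not coprime to $d$) with values in $\mathbb{C}_p$ via a fixed embedding $\overline{\mathbb{Q}}\to\mathbb{C}_p$. For a ramified root of unity $\zeta$ (e.g. $\zeta=\xi^{w}$), the generalized twisted Euler polynomials $E_{n,\chi,\zeta}(x)$ are the polynomials in $x$ (evaluated at arbitrary $x\in\mathbb{C}_p$) defined by $$\frac{2e^{xt}}{\zeta^d e^{dt}+1}\sum_{a=0}^{d-1}(-1)^a\chi(a)\zeta^a e^{at}=\sum_{n=0}^{\infty}E_{n,\chi,\zeta}(x)\frac{t^n}{n!}.$$ *)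

theory Defs
  imports "HOL-Analysis.Analysis" "HOL-Computational_Algebra.Computational_Algebra"
begin

text \<open>
  The field of p-adic complex numbers is not available as a type. It is determined up to
  isometric field isomorphism as a completion of an algebraic closure of the p-adic numbers,
  and the predicate \<open>is_Cp\<close> below says that a field type with a complete metric is
  such a completion. The absolute value of \<open>x\<close> is \<open>dist x 0\<close>.
  Inside such a field, the p-adic numbers are the topological closure of the rationals (the
  absolute value restricts to the usual one on the rationals since \<open>p\<close> is sent to
  \<open>1 / p\<close>).
\<close>

definition Qp :: "'a :: {field_char_0, metric_space} set"
  where "Qp = closure \<rat>"

definition Zp :: "'a :: {field_char_0, metric_space} set"
  where "Zp = {x \<in> Qp. dist x 0 \<le> 1}"

definition Qp_alg :: "'a :: {field_char_0, metric_space} set"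
  where "Qp_alg = {x. \<exists>q. q \<noteq> 0 \<and> (\<forall>i. coeff q i \<in> Qp) \<and> poly q x = 0}"

definition is_Cp :: "'a :: {field_char_0, complete_space} itself \<Rightarrow> nat \<Rightarrow> bool"
  where "is_Cp K p \<longleftrightarrow>
    (\<forall>x y :: 'a. dist x y = dist (x - y) 0) \<and>
    (\<forall>x y :: 'a. dist (x * y) 0 = dist x 0 * dist y 0) \<and>
    (\<forall>x y :: 'a. dist (x + y) 0 \<le> max (dist x 0) (dist y 0)) \<and>
    dist (of_nat p :: 'a) 0 = 1 / real p \<and>
    (\<forall>q :: 'a poly. degree q > 0 \<longrightarrow> (\<forall>i. coeff q i \<in> Qp_alg) \<longrightarrow>
       (\<exists>x \<in> Qp_alg. poly q x = 0)) \<and>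
    closure (Qp_alg :: 'a set) = UNIV"

definition Qbar_embedding :: "(complex \<Rightarrow> 'a :: field_char_0) \<Rightarrow> bool"
  where "Qbar_embedding \<iota> \<longleftrightarrow>
    \<iota> 1 = 1 \<and>
    (\<forall>x y. algebraic x \<longrightarrow> algebraic y \<longrightarrow>
       \<iota> (x + y) = \<iota> x + \<iota> y \<and> \<iota> (x * y) = \<iota> x * \<iota> y)"

definition ramified_root_of_unity :: "nat \<Rightarrow> 'a :: field_char_0 \<Rightarrow> bool"
  where "ramified_root_of_unity p \<xi> \<longleftrightarrow> (\<exists>s>0. \<xi> ^ (p ^ s) = 1)"

definition dirichlet_char :: "nat \<Rightarrow> (int \<Rightarrow> complex) \<Rightarrow> bool"
  where "dirichlet_char m chi \<longleftrightarrow> m > 0 \<and>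
    (\<forall>a. chi (a + int m) = chi a) \<and>
    (\<forall>a b. chi (a * b) = chi a * chi b) \<and>
    (\<forall>a. chi a \<noteq> 0 \<longleftrightarrow> coprime a (int m))"

text \<open>
  A divisor \<open>f\<close> of \<open>m\<close> is an induced modulus of a character modulo
  \<open>m\<close> if the character, on the units modulo \<open>m\<close>, factors through the units
  modulo \<open>f\<close>; the conductor is the least induced modulus.
\<close>

definition induced_modulus :: "nat \<Rightarrow> (int \<Rightarrow> complex) \<Rightarrow> nat \<Rightarrow> bool"
  where "induced_modulus m chi f \<longleftrightarrow> f dvd m \<and>
    (\<forall>a. coprime a (int m) \<longrightarrow> a mod int f = 1 mod int f \<longrightarrow> chi a = 1)"

definition conductor :: "nat \<Rightarrow> (int \<Rightarrow> complex) \<Rightarrow> nat"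
  where "conductor m chi = (LEAST f. induced_modulus m chi f)"

definition primitive_dirichlet_char :: "nat \<Rightarrow> (int \<Rightarrow> complex) \<Rightarrow> bool"
  where "primitive_dirichlet_char d chi \<longleftrightarrow> dirichlet_char d chi \<and> conductor d chi = d"

definition twisted_euler_gf ::
    "nat \<Rightarrow> (int \<Rightarrow> 'a :: field_char_0) \<Rightarrow> 'a \<Rightarrow> 'a \<Rightarrow> 'a fps"
  where "twisted_euler_gf d chi \<zeta> x =
    2 * fps_exp x / (fps_const (\<zeta> ^ d) * fps_exp (of_nat d) + 1) *
      (\<Sum>a<d. fps_const ((-1) ^ a * chi (int a) * \<zeta> ^ a) * fps_exp (of_nat a))"

definition twisted_euler ::
    "nat \<Rightarrow> (int \<Rightarrow> 'a :: field_char_0) \<Rightarrow> nat \<Rightarrow> 'a \<Rightarrow> 'a \<Rightarrow> 'a"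
  where "twisted_euler d chi n \<zeta> x = fact n * fps_nth (twisted_euler_gf d chi \<zeta> x) n"

text \<open>
  The quotient above is a genuine one: for odd \<open>p\<close> and \<open>d\<close> and a ramified
  root of unity the denominator is invertible. The values are then polynomial in \<open>x\<close>.
\<close>

lemma twisted_euler_denominator_unit:
  fixes \<zeta> :: "'a :: field_char_0"
  assumes "odd p" "ramified_root_of_unity p \<zeta>"
  shows "fps_nth (fps_const (\<zeta> ^ d) * fps_exp (of_nat d) + 1) 0 \<noteq> 0"
proof
  obtain s where s: "\<zeta> ^ (p ^ s) = 1"
    using assms(2) by (auto simp: ramified_root_of_unity_def)
  assume "fps_nth (fps_const (\<zeta> ^ d) * fps_exp (of_nat d) + 1) 0 = 0"
  hence "\<zeta> ^ d = -1" by (simp add: add_eq_0_iff2)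
  hence "(\<zeta> ^ d) ^ (p ^ s) = -1" using assms(1) by simp
  moreover have "(\<zeta> ^ d) ^ (p ^ s) = 1"
    by (metis s power_mult mult.commute power_one)
  ultimately show False by simp
qed

lemma twisted_euler_polynomial:
  fixes \<zeta> :: "'a :: field_char_0"
  assumes "odd p" "ramified_root_of_unity p \<zeta>"
  shows "\<exists>q :: 'a poly. \<forall>x. twisted_euler d chi n \<zeta> x = poly q x"
proof -
  define D where "D = fps_const (\<zeta> ^ d) * fps_exp (of_nat d) + 1"
  define G where "G = 2 * inverse D *
      (\<Sum>a<d. fps_const ((-1) ^ a * chi (int a) * \<zeta> ^ a) * fps_exp (of_nat a))"
  have "fps_nth D 0 \<noteq> 0"
    unfolding D_def by (rule twisted_euler_denominator_unit[OF assms])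
  hence gf: "twisted_euler_gf d chi \<zeta> x = fps_exp x * G" for x
    unfolding twisted_euler_gf_def D_def[symmetric] G_def
    by (simp add: fps_divide_unit mult_ac)
  have "twisted_euler d chi n \<zeta> x =
      poly (\<Sum>i\<le>n. monom (fact n / fact i * fps_nth G (n - i)) i) x" for x
    unfolding twisted_euler_def gf fps_mult_nth
    by (simp add: poly_sum poly_monom sum_distrib_left atLeast0AtMost field_simps)
  thus ?thesis by blast
qed

end

theory Submission
  imports Defs
begin

text \<open>
  With \<open>F m = S (m t) / (\<xi>^(m d) e^(m d t) + 1)\<close>, where \<open>S\<close> is the character
  sum over a period for \<open>\<xi>^m\<close>, the exponential generating function of each of the six
  expressions is
  \<open>4 e^(w1 w2 w3 (y1 + y2) t) (\<xi>^(w1 w2 w3 d) e^(w1 w2 w3 d t) + 1) F(w1 w2) F(w1 w3) F(w2 w3)\<close>,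
  which is symmetric in \<open>w1, w2, w3\<close>. The inner sum over \<open>a < w d\<close> collapses to one
  period because the character is periodic and \<open>w\<close>, \<open>d\<close> are odd, which leaves a
  finite geometric series.
\<close>

text \<open>The scale \<open>c\<close> stands for the substitution of \<open>c t\<close> for
  \<open>t\<close>. The length \<open>m\<close> is independent of the period of \<open>X\<close>, so
  that one period and \<open>w\<close> periods are instances of the same sum.\<close>

definition twisted_sum ::
    "(int \<Rightarrow> 'a :: field_char_0) \<Rightarrow> 'a \<Rightarrow> 'a \<Rightarrow> nat \<Rightarrow> 'a fps"
  where "twisted_sum X \<zeta> c m =
    (\<Sum>a<m. fps_const ((-1) ^ a * X (int a) * \<zeta> ^ a) * fps_exp (c * of_nat a))"

definition twisted_denom :: "'a :: field_char_0 \<Rightarrow> 'a \<Rightarrow> nat \<Rightarrow> 'a fps"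
  where "twisted_denom \<zeta> c m = fps_const (\<zeta> ^ m) * fps_exp (c * of_nat m) + 1"

lemma periodic_multiple:
  fixes X :: "int \<Rightarrow> 'a"
  assumes "\<And>a. X (a + int d) = X a"
  shows "X (int (w * d + m)) = X (int m)"
proof (induction w)
  case (Suc w)
  have "int (Suc w * d + m) = int (w * d + m) + int d" by simp
  then show ?case using assms Suc.IH by metis
qed simp

text \<open>Moving the index by \<open>d\<close> multiplies a term by
  \<open>- (\<zeta> ^ d) * e^(c d t)\<close>, the sign coming from the oddness of \<open>d\<close>.
  This factor is exactly \<open>1 - twisted_denom \<zeta> c d\<close>, so the terms after the first
  \<open>w\<close> periods repeat the initial ones up to its \<open>w\<close>-th power.\<close>

lemma twisted_sum_shift:
  fixes X :: "int \<Rightarrow> 'a :: field_char_0"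
  assumes per: "\<And>a. X (a + int d) = X a" and d: "odd d"
  shows "twisted_sum X \<zeta> c (w * d + m) = twisted_sum X \<zeta> c (w * d) +
           (1 - twisted_denom \<zeta> c d) ^ w * twisted_sum X \<zeta> c m"
proof (induction m)
  case 0
  then show ?case by (simp add: twisted_sum_def)
next
  case (Suc m)
  have s: "(-1 :: 'a) ^ (w * d + m) = (-1) ^ w * (-1) ^ m"
    using d by (simp add: power_add power_mult mult.commute[of w d])
  have "1 - twisted_denom \<zeta> c d = fps_const (- (\<zeta> ^ d)) * fps_exp (c * of_nat d)"
    by (simp add: twisted_denom_def flip: fps_const_neg)
  then have q: "(1 - twisted_denom \<zeta> c d) ^ w =
      fps_const ((-1) ^ w * \<zeta> ^ (w * d)) * fps_exp (c * of_nat (w * d))"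
    by (simp add: power_mult_distrib fps_const_power fps_exp_power_mult
        power_mult[symmetric] mult_ac power_minus[of "\<zeta> ^ d"]
        del: fps_const_mult fps_const_neg)
  have "fps_const ((-1) ^ (w * d + m) * X (int (w * d + m)) * \<zeta> ^ (w * d + m)) *
          fps_exp (c * of_nat (w * d + m)) =
        (1 - twisted_denom \<zeta> c d) ^ w *
          (fps_const ((-1) ^ m * X (int m) * \<zeta> ^ m) * fps_exp (c * of_nat m))"
    unfolding s periodic_multiple[of X, OF per] q
    by (simp add: power_add distrib_left fps_exp_add_mult mult_ac flip: fps_const_mult)
  then show ?case
    using Suc.IH by (simp add: twisted_sum_def distrib_left)
qed

text \<open>Cutting the range into \<open>w\<close> periods gives a geometric series with ratio
  \<open>1 - twisted_denom \<zeta> c d\<close>. Its closed form appears here with the denominator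
  cleared, which avoids division of power series.\<close>

lemma twisted_sum_multiple:
  fixes X :: "int \<Rightarrow> 'a :: field_char_0"
  assumes per: "\<And>a. X (a + int d) = X a" and d: "odd d" and w: "odd w"
  shows "twisted_denom \<zeta> c d * twisted_sum X \<zeta> c (w * d) =
           twisted_denom \<zeta> c (w * d) * twisted_sum X \<zeta> c d"
proof -
  \<comment> \<open>The induction runs over all \<open>v\<close>, since parity changes from
    \<open>v\<close> to \<open>Suc v\<close>. Oddness of \<open>w\<close> enters afterwards, to turn
    \<open>1 - (ratio)^w\<close> into a denominator.\<close>
  have "twisted_denom \<zeta> c d * twisted_sum X \<zeta> c (v * d) =
      (1 - (1 - twisted_denom \<zeta> c d) ^ v) * twisted_sum X \<zeta> c d" for v
  proof (induction v)
    case 0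
    then show ?case by (simp add: twisted_sum_def)
  next
    case (Suc v)
    have "twisted_sum X \<zeta> c (Suc v * d) = twisted_sum X \<zeta> c (v * d) +
        (1 - twisted_denom \<zeta> c d) ^ v * twisted_sum X \<zeta> c d"
      using twisted_sum_shift[of X, OF per d, of \<zeta> c v d] by (simp add: add.commute)
    then show ?case
      using Suc.IH by (simp add: algebra_simps)
  qed
  moreover have "1 - (1 - twisted_denom \<zeta> c d) ^ w = twisted_denom \<zeta> c (w * d)"
    using w by (simp add: twisted_denom_def power_mult_distrib fps_const_power
        fps_exp_power_mult power_mult[symmetric] mult_ac)
  ultimately show ?thesis by simp
qed

lemma twisted_denom_unit:
  fixes \<zeta> :: "'a :: field_char_0"
  assumes "odd p" "ramified_root_of_unity p \<zeta>"
  shows "fps_nth (twisted_denom \<zeta> c d) 0 \<noteq> 0"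
  using twisted_euler_denominator_unit[OF assms, of d] by (simp add: twisted_denom_def)

lemma ramified_root_of_unity_power:
  assumes "ramified_root_of_unity p \<xi>"
  shows "ramified_root_of_unity p (\<xi> ^ m)"
  using assms unfolding ramified_root_of_unity_def
  by (metis power_mult mult.commute power_one)

text \<open>Weighting the \<open>n\<close>-th coefficient by \<open>c ^ n\<close> is composition
  with \<open>c t\<close>. Composition respects sums and products, and also the inverse because the
  denominator has nonzero constant term.\<close>

lemma twisted_euler_gf_scale:
  fixes \<zeta> :: "'a :: field_char_0"
  assumes "odd p" "ramified_root_of_unity p \<zeta>"
  shows "Abs_fps (\<lambda>n. c ^ n * fps_nth (twisted_euler_gf d X \<zeta> x) n) =
    2 * fps_exp (c * x) * inverse (twisted_denom \<zeta> c d) * twisted_sum X \<zeta> c d"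
proof -
  let ?l = "fps_const c * fps_X"
  have l: "fps_nth ?l 0 = 0" by simp
  have u: "fps_nth (twisted_denom \<zeta> b d) 0 \<noteq> 0" for b
    by (rule twisted_denom_unit[OF assms])
  have e: "fps_exp a oo ?l = fps_exp (c * a)" for a :: 'a
    by (simp add: mult.commute[of c a])
  have gf: "twisted_euler_gf d X \<zeta> x =
      2 * fps_exp x * inverse (twisted_denom \<zeta> 1 d) * twisted_sum X \<zeta> 1 d"
    using u[of 1]
    by (simp add: twisted_euler_gf_def twisted_denom_def twisted_sum_def fps_divide_unit)
  have D: "twisted_denom \<zeta> 1 d oo ?l = twisted_denom \<zeta> c d"
    by (simp add: twisted_denom_def fps_compose_add_distrib fps_compose_mult_distrib[OF l] e
        del: fps_exp_compose_linear)
  have T: "twisted_sum X \<zeta> 1 d oo ?l = twisted_sum X \<zeta> c d"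
    by (simp add: twisted_sum_def fps_compose_sum_distrib fps_compose_mult_distrib[OF l] e
        del: fps_exp_compose_linear)
  have two: "(2 :: 'a fps) oo ?l = 2"
    by (metis fps_const_compose numeral_fps_const)
  have "Abs_fps (\<lambda>n. c ^ n * fps_nth (twisted_euler_gf d X \<zeta> x) n) =
      twisted_euler_gf d X \<zeta> x oo ?l"
    by (simp add: fps_compose_linear)
  then show ?thesis
    by (simp only: gf fps_compose_mult_distrib[OF l] fps_inverse_compose[OF l u] D T two e)
qed

text \<open>Products of exponential generating functions are binomial convolutions of their
  coefficient sequences.\<close>

lemma fact_mult_fps_nth_mult:
  fixes f g :: "'a :: field_char_0 fps"
  shows "fact n * fps_nth (f * g) n =
    (\<Sum>k\<le>n. of_nat (n choose k) * (fact k * fps_nth f k) * (fact (n - k) * fps_nth g (n - k)))"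
  unfolding fps_mult_nth sum_distrib_left atLeast0AtMost
  by (rule sum.cong) (simp_all add: binomial_fact)

text \<open>The constant 4 collects the factors 2 of the two Euler generating functions.\<close>

definition symmetric_gf ::
    "nat \<Rightarrow> (int \<Rightarrow> 'a :: field_char_0) \<Rightarrow> 'a \<Rightarrow> 'a \<Rightarrow> nat \<Rightarrow> nat \<Rightarrow> nat \<Rightarrow> 'a fps"
  where "symmetric_gf d X \<xi> y w1 w2 w3 =
    (let F = (\<lambda>m. inverse (twisted_denom (\<xi> ^ m) (of_nat m) d) *
                  twisted_sum X (\<xi> ^ m) (of_nat m) d)
     in 4 * fps_exp (of_nat (w1 * w2 * w3) * y) *
        twisted_denom (\<xi> ^ (w1 * w2 * w3)) (of_nat (w1 * w2 * w3)) d *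
        F (w1 * w2) * F (w1 * w3) * F (w2 * w3))"

text \<open>These two adjacent transpositions generate all permutations of the weights.\<close>

lemma symmetric_gf_swap:
  "symmetric_gf d X \<xi> y w1 w3 w2 = symmetric_gf d X \<xi> y w1 w2 w3"
  "symmetric_gf d X \<xi> y w2 w1 w3 = symmetric_gf d X \<xi> y w1 w2 w3"
  by (simp_all add: symmetric_gf_def Let_def mult_ac)

text \<open>The expression is a binomial convolution of two scaled sequences, so its generating
  function is a product. One of the six expressions suffices, since the others arise from it by
  permuting the weights.\<close>

lemma twisted_euler_sum_eq_symmetric_gf:
  fixes \<xi> :: "'a :: field_char_0"
  assumes p: "odd p" "ramified_root_of_unity p \<xi>"
    and per: "\<And>a. X (a + int d) = X a" and d: "odd d" and w1: "odd w1"
  shows "of_nat w1 ^ n * (\<Sum>k\<le>n. of_nat (n choose k) *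
            twisted_euler d X k (\<xi> ^ (w1 * w2)) (of_nat w3 * y1) *
            (\<Sum>a<w1 * d. (-1) ^ a * X (int a) * \<xi> ^ (a * w2 * w3) *
              twisted_euler d X (n - k) (\<xi> ^ (w1 * w3))
                (of_nat w2 * y2 + of_nat w2 / of_nat w1 * of_nat a)) *
            of_nat w3 ^ (n - k) * of_nat w2 ^ k) =
         fact n * fps_nth (symmetric_gf d X \<xi> (y1 + y2) w1 w2 w3) n"
    (is "?lhs = _")
proof -
  let ?gf = "twisted_euler_gf d X"
  let ?z = "\<lambda>a. of_nat w2 * y2 + of_nat w2 / of_nat w1 * of_nat a :: 'a"
  let ?u = "\<lambda>a. (-1) ^ a * X (int a) * \<xi> ^ (a * w2 * w3)"
  let ?D = "\<lambda>m. twisted_denom (\<xi> ^ m) (of_nat m) d"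
  let ?S = "\<lambda>m. twisted_sum X (\<xi> ^ m) (of_nat m)"
  \<comment> \<open>The scales \<open>w1 * w2\<close> and \<open>w1 * w3\<close> come from sharing
    out \<open>w1 ^ n\<close> as \<open>w1 ^ k * w1 ^ (n - k)\<close> next to \<open>w2 ^ k\<close>
    and \<open>w3 ^ (n - k)\<close>.\<close>
  define f where
    "f = Abs_fps (\<lambda>k. of_nat (w1 * w2) ^ k * fps_nth (?gf (\<xi> ^ (w1 * w2)) (of_nat w3 * y1)) k)"
  define h where
    "h a = Abs_fps (\<lambda>k. of_nat (w1 * w3) ^ k * fps_nth (?gf (\<xi> ^ (w1 * w3)) (?z a)) k)" for a
  define g where "g = (\<Sum>a<w1 * d. fps_const (?u a) * h a)"
  note ram = ramified_root_of_unity_power[OF p(2)]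
  have w1_nz: "of_nat w1 \<noteq> (0 :: 'a)" using w1 by (auto simp: odd_pos)
  have f_eq: "f = 2 * fps_exp (of_nat (w1 * w2 * w3) * y1) *
      inverse (?D (w1 * w2)) * ?S (w1 * w2) d"
    unfolding f_def twisted_euler_gf_scale[OF p(1) ram] by (simp add: mult_ac)
  \<comment> \<open>Scaling cancels the division by \<open>w1\<close>. The dependence on
    \<open>a\<close> then sits in a separate exponential factor, the one required by the character
    sum for \<open>\<xi> ^ (w2 * w3)\<close>.\<close>
  have z: "of_nat (w1 * w3) * ?z a =
      of_nat (w1 * w2 * w3) * y2 + of_nat (w2 * w3) * of_nat a" for a
    using w1_nz by (simp add: field_simps)
  have h_eq: "h a = 2 * fps_exp (of_nat (w1 * w2 * w3) * y2) *
      inverse (?D (w1 * w3)) * ?S (w1 * w3) d * fps_exp (of_nat (w2 * w3) * of_nat a)" for a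
    unfolding h_def twisted_euler_gf_scale[OF p(1) ram] z fps_exp_add_mult
    by (simp add: mult_ac)
  have "g = 2 * fps_exp (of_nat (w1 * w2 * w3) * y2) *
      inverse (?D (w1 * w3)) * ?S (w1 * w3) d * ?S (w2 * w3) (w1 * d)"
    unfolding g_def h_eq twisted_sum_def[of _ _ _ "w1 * d"] sum_distrib_left
    by (intro sum.cong) (simp_all add: mult_ac power_mult[symmetric] del: of_nat_mult)
  moreover have "?S (w2 * w3) (w1 * d) =
      inverse (?D (w2 * w3)) * (?D (w1 * w2 * w3) * ?S (w2 * w3) d)"
  proof -
    \<comment> \<open>Lengthening the range by \<open>w1\<close> has the same effect on the
      denominator as raising the twist and the scale by \<open>w1\<close>; this produces the
      symmetric middle factor.\<close>
    have "twisted_denom (\<xi> ^ (w2 * w3)) (of_nat (w2 * w3)) (w1 * d) = ?D (w1 * w2 * w3)"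
      by (simp add: twisted_denom_def power_mult[symmetric] mult_ac)
    then have "?D (w2 * w3) * ?S (w2 * w3) (w1 * d) = ?D (w1 * w2 * w3) * ?S (w2 * w3) d"
      using twisted_sum_multiple[of X, OF per d w1, of "\<xi> ^ (w2 * w3)" "of_nat (w2 * w3)"]
      by simp
    from this[symmetric] show ?thesis
      using inverse_mult_eq_1[OF twisted_denom_unit[OF p(1) ram]]
      by (simp only: mult.assoc[symmetric] mult_1)
  qed
  ultimately have "f * g = symmetric_gf d X \<xi> (y1 + y2) w1 w2 w3"
    unfolding f_eq symmetric_gf_def Let_def distrib_left fps_exp_add_mult
    by (simp add: mult_ac)
  moreover have "?lhs = fact n * fps_nth (f * g) n"
    unfolding fact_mult_fps_nth_mult sum_distrib_left[of "of_nat w1 ^ n"]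
  proof (rule sum.cong[OF refl])
    fix k assume "k \<in> {..n}"
    then have n: "of_nat w1 ^ n = (of_nat w1 ^ k * of_nat w1 ^ (n - k) :: 'a)"
      by (simp flip: power_add)
    have fk: "fact k * fps_nth f k = of_nat w1 ^ k * of_nat w2 ^ k *
        twisted_euler d X k (\<xi> ^ (w1 * w2)) (of_nat w3 * y1)"
      by (simp add: f_def twisted_euler_def power_mult_distrib mult_ac)
    have gk: "fact (n - k) * fps_nth g (n - k) = of_nat w1 ^ (n - k) * of_nat w3 ^ (n - k) *
        (\<Sum>a<w1 * d. ?u a * twisted_euler d X (n - k) (\<xi> ^ (w1 * w3)) (?z a))"
      unfolding g_def fps_sum_nth sum_distrib_left
      by (rule sum.cong) (simp_all add: h_def twisted_euler_def power_mult_distrib mult_ac)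
    show "of_nat w1 ^ n * (of_nat (n choose k) *
            twisted_euler d X k (\<xi> ^ (w1 * w2)) (of_nat w3 * y1) *
            (\<Sum>a<w1 * d. ?u a * twisted_euler d X (n - k) (\<xi> ^ (w1 * w3)) (?z a)) *
            of_nat w3 ^ (n - k) * of_nat w2 ^ k) =
          of_nat (n choose k) * (fact k * fps_nth f k) * (fact (n - k) * fps_nth g (n - k))"
      unfolding fk gk n by (simp only: mult_ac)
  qed
  ultimately show ?thesis by simp
qed

theorem theorem3:
  fixes \<xi> y1 y2 :: "'a :: {field_char_0, complete_space}"
    and \<iota> :: "complex \<Rightarrow> 'a" and chi :: "int \<Rightarrow> complex"
    and p d n w1 w2 w3 :: nat
  assumes "prime p" "odd p"
    and "is_Cp TYPE('a) p"
    and "ramified_root_of_unity p \<xi>"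
    and "odd d"
    and "primitive_dirichlet_char d chi"
    and "Qbar_embedding \<iota>"
    and "odd w1" "odd w2" "odd w3"
    and "y1 \<in> Zp" "y2 \<in> Zp"
  shows "let X = (\<lambda>a. \<iota> (chi a));
         E = twisted_euler d X;
         A1 = of_nat w1 ^ n * (\<Sum>k\<le>n. of_nat (n choose k) * E k (\<xi> ^ (w1 * w2)) (of_nat w3 * y1) *
            (\<Sum>a<w1 * d. (-1) ^ a * X (int a) * \<xi> ^ (a * w2 * w3) *
              E (n - k) (\<xi> ^ (w1 * w3)) (of_nat w2 * y2 + of_nat w2 / of_nat w1 * of_nat a)) *
            of_nat w3 ^ (n - k) * of_nat w2 ^ k);
         A2 = of_nat w1 ^ n * (\<Sum>k\<le>n. of_nat (n choose k) * E k (\<xi> ^ (w1 * w3)) (of_nat w2 * y1) *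
            (\<Sum>a<w1 * d. (-1) ^ a * X (int a) * \<xi> ^ (a * w2 * w3) *
              E (n - k) (\<xi> ^ (w1 * w2)) (of_nat w3 * y2 + of_nat w3 / of_nat w1 * of_nat a)) *
            of_nat w2 ^ (n - k) * of_nat w3 ^ k);
         A3 = of_nat w2 ^ n * (\<Sum>k\<le>n. of_nat (n choose k) * E k (\<xi> ^ (w1 * w2)) (of_nat w3 * y1) *
            (\<Sum>a<w2 * d. (-1) ^ a * X (int a) * \<xi> ^ (a * w1 * w3) *
              E (n - k) (\<xi> ^ (w2 * w3)) (of_nat w1 * y2 + of_nat w1 / of_nat w2 * of_nat a)) *
            of_nat w3 ^ (n - k) * of_nat w1 ^ k);
         A4 = of_nat w2 ^ n * (\<Sum>k\<le>n. of_nat (n choose k) * E k (\<xi> ^ (w2 * w3)) (of_nat w1 * y1) *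
            (\<Sum>a<w2 * d. (-1) ^ a * X (int a) * \<xi> ^ (a * w1 * w3) *
              E (n - k) (\<xi> ^ (w1 * w2)) (of_nat w3 * y2 + of_nat w3 / of_nat w2 * of_nat a)) *
            of_nat w1 ^ (n - k) * of_nat w3 ^ k);
         A5 = of_nat w3 ^ n * (\<Sum>k\<le>n. of_nat (n choose k) * E k (\<xi> ^ (w1 * w3)) (of_nat w2 * y1) *
            (\<Sum>a<w3 * d. (-1) ^ a * X (int a) * \<xi> ^ (a * w1 * w2) *
              E (n - k) (\<xi> ^ (w2 * w3)) (of_nat w1 * y2 + of_nat w1 / of_nat w3 * of_nat a)) *
            of_nat w2 ^ (n - k) * of_nat w1 ^ k);
         A6 = of_nat w3 ^ n * (\<Sum>k\<le>n. of_nat (n choose k) * E k (\<xi> ^ (w2 * w3)) (of_nat w1 * y1) *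
            (\<Sum>a<w3 * d. (-1) ^ a * X (int a) * \<xi> ^ (a * w1 * w2) *
              E (n - k) (\<xi> ^ (w1 * w3)) (of_nat w2 * y2 + of_nat w2 / of_nat w3 * of_nat a)) *
            of_nat w1 ^ (n - k) * of_nat w2 ^ k)
     in A1 = A2 \<and> A2 = A3 \<and> A3 = A4 \<and> A4 = A5 \<and> A5 = A6"
proof -
  define X where "X = (\<lambda>a. \<iota> (chi a))"
  define G where "G = symmetric_gf d X \<xi> (y1 + y2)"
  have per: "X (a + int d) = X a" for a
    using assms(6) by (simp add: X_def primitive_dirichlet_char_def dirichlet_char_def)
  note eq = twisted_euler_sum_eq_symmetric_gf[of p \<xi> X d, OF assms(2,4) per \<open>odd d\<close>,
      of _ n _ _ y1 y2, folded G_def]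
  have G: "G w1 w3 w2 = G w1 w2 w3" "G w2 w1 w3 = G w1 w2 w3" "G w2 w3 w1 = G w1 w2 w3"
    "G w3 w1 w2 = G w1 w2 w3" "G w3 w2 w1 = G w1 w2 w3"
    unfolding G_def by (metis symmetric_gf_swap)+
  show ?thesis
    unfolding Let_def X_def[symmetric]
    \<comment> \<open>Each instance puts a different ordering of the weights into the lemma, and
      \<open>G\<close> reduces all right-hand sides to one. The left-hand sides match the stated
      expressions up to the order of factors, such as \<open>w2 * w1\<close> for
      \<open>w1 * w2\<close>.\<close>
    using eq[OF \<open>odd w1\<close>, of w2 w3] eq[OF \<open>odd w1\<close>, of w3 w2, unfolded G]
      eq[OF \<open>odd w2\<close>, of w1 w3, unfolded G] eq[OF \<open>odd w2\<close>, of w3 w1, unfolded G]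
      eq[OF \<open>odd w3\<close>, of w1 w2, unfolded G] eq[OF \<open>odd w3\<close>, of w2 w1, unfolded G]
    by (simp only: mult_ac)
qed

end
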